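(* Let $A,B,C,D\in\mathbb{R}^2$, consider the quadrilateral $ABDC$ and the equation $$\mathbf{0}=(1-\alpha)\big((1-\beta)A+\beta B\big)+\alpha\big((1-\beta)C+\beta D\big)\qquad( * )$$ in the unknown $(\alpha,\beta)\in\mathbb{R}^2$. (i) If $A=B=C=D$, then $( * )$ has no solution unless $A=B=C=D=\mathbf{0}$, in which case $(\alpha,\beta)$ can be arbitrary. (ii) If the points do not all coincide and $A,B,C,D$ lie on a line $\ell$, then $( * )$ has no solution unless $\ell$ goes through the origin, in which case it has a one-dimensional solution space. (iii) If the points are not collinear and $ABDC$ is a parallelogram, then $( * )$ has a unique solution, given by $$(\alpha,\beta)=\frac{1}{p_{BC}+p_{CA}+p_{AB}}\,(p_{AB},\,p_{CA}).$$ (iv) If $ABDC$ is a trapezium with the edges $AC$ and $BD$ parallel, and $AB$ and $CD$ not parallel, let $P$ be the point of intersection of the lines through $AB$ and $CD$, and let $\ell$ be the line through $P$ parallel to $AC$ and $BD$. If $P=\mathbf{0}$, the solutions of $( * )$ are $$(\alpha,\beta)=\left(\gamma,\ \frac{p_{AB}+p_{AC}+p_{DA}}{p_{AC}+p_{CB}+p_{BD}+p_{DA}}\right),\quad\gamma\in\mathbb{R}.$$ If $P\neq\mathbf{0}$ and $\ell$ passes through $\mathbf{0}$, there are no solutions. If $\ell$ does not pass through $\mathbf{0}$, there is a unique solution, given by $$(\alpha,\beta)=\left(\frac{p_{AB}}{p_{AB}+p_{DC}},\ \frac{p_{AB}+p_{AC}+p_{DA}}{p_{AC}+p_{CB}+p_{BD}+p_{DA}}\right).$$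 (v) If the edges $AB$ and $CD$ are parallel, and $AC$ and $BD$ are not, the same conclusions as in (iv) hold with $\alpha$ and $\beta$, and $B$ and $C$, switched. That is, let $P$ be the point of intersection of the lines through $AC$ and $BD$, and $\ell$ the line through $P$ parallel to $AB$ and $CD$. If $P=\mathbf{0}$, the solutions are $(\alpha,\beta)=\left(\frac{p_{AC}+p_{AB}+p_{DA}}{p_{AB}+p_{BC}+p_{CD}+p_{DA}},\gamma\right)$, $\gamma\in\mathbb{R}$; if $P\ne\mathbf{0}$ and $\ell$ passes through $\mathbf{0}$, there are no solutions; if $\ell$ does not pass through $\mathbf{0}$, there is a unique solution $(\alpha,\beta)=\left(\frac{p_{AC}+p_{AB}+p_{DA}}{p_{AB}+p_{BC}+p_{CD}+p_{DA}},\frac{p_{AC}}{p_{AC}+p_{DB}}\right)$. (vi) If neither $AB$ and $CD$ nor $AC$ and $BD$ are parallel, let $\Delta=(p_{AD}+p_{CB})^2-4p_{AB}p_{CD}$. If $\Delta\ge0$, the solutions of $( * )$ are $$(\alpha,\beta)=\left(\frac{2p_{AB}+p_{BC}+p_{DA}\pm\sqrt{\Delta}}{2(p_{AB}+p_{BC}+p_{CD}+p_{DA})},\ \frac{2p_{AC}+p_{CB}+p_{DA}\mp\sqrt{\Delta}}{2(p_{AC}+p_{CB}+p_{BD}+p_{DA})}\right)$$ (opposite signs in the two coordinates). If $\Delta<0$, there are no real solutions.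
   Context: For $V=(V_1,V_2)$ and $W=(W_1,W_2)$ in $\mathbb{R}^2$, $p_{VW}=\det\begin{pmatrix} V_1 & W_1 \\ V_2 & W_2 \end{pmatrix}=V_1W_2-V_2W_1$; thus $p_{VW}=-p_{WV}$. Two vectors are called parallel if their span is at most one-dimensional; in particular the zero vector is parallel to every vector. Edges $XY$ and $ZT$ are parallel if the vectors $X-Y$ and $Z-T$ are parallel. The quadrilateral $ABDC$ has consecutive vertices $A,B,D,C$ and may be degenerate or self-intersecting; its pairs of opposite edges are $\{AB,CD\}$ and $\{AC,BD\}$, and it is a parallelogram if $A-B-C+D=\mathbf{0}$. *)

theory Defs
  imports "HOL-Analysis.Analysis"
begin

definition p :: "real^2 \<Rightarrow> real^2 \<Rightarrow> real" where
  "p V W = det (vector [vector [V$1, W$1], vector [V$2, W$2]] :: real^2^2)"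

definition parallel :: "real^2 \<Rightarrow> real^2 \<Rightarrow> bool" where
  "parallel V W \<longleftrightarrow> dim (span {V, W}) \<le> 1"

definition edges_parallel :: "real^2 \<Rightarrow> real^2 \<Rightarrow> real^2 \<Rightarrow> real^2 \<Rightarrow> bool" where
  "edges_parallel X Y Z T \<longleftrightarrow> parallel (X - Y) (Z - T)"

(* The arguments are the consecutive vertices, so the quadrilateral ABDC is passed
   as A B D C; it may be degenerate. *)
definition parallelogram :: "real^2 \<Rightarrow> real^2 \<Rightarrow> real^2 \<Rightarrow> real^2 \<Rightarrow> bool" where
  "parallelogram A B D C \<longleftrightarrow> A - B - C + D = 0"

definition is_line :: "(real^2) set \<Rightarrow> bool" where
  "is_line L \<longleftrightarrow> affine L \<and> aff_dim L = 1"

(* The edge XY may be degenerate (X = Y), in which case every line is parallel to it. *)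
definition line_parallel_to_edge :: "(real^2) set \<Rightarrow> real^2 \<Rightarrow> real^2 \<Rightarrow> bool" where
  "line_parallel_to_edge L X Y \<longleftrightarrow> (\<forall>U\<in>L. \<forall>V\<in>L. parallel (U - V) (X - Y))"

definition solutions :: "real^2 \<Rightarrow> real^2 \<Rightarrow> real^2 \<Rightarrow> real^2 \<Rightarrow> (real \<times> real) set" where
  "solutions A B C D = {(\<alpha>, \<beta>).
     0 = (1 - \<alpha>) *\<^sub>R ((1 - \<beta>) *\<^sub>R A + \<beta> *\<^sub>R B) + \<alpha> *\<^sub>R ((1 - \<beta>) *\<^sub>R C + \<beta> *\<^sub>R D)}"

(* Small inductive dimension exactly 1 in the subspace topology. Linear or affine dimension
   would be wrong here: for collinear points the solution set is in general a hyperbola or a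
   pair of lines. A one-dimensional set is nonempty, since the empty set has dimension -1. *)
definition one_dimensional :: "(real \<times> real) set \<Rightarrow> bool" where
  "one_dimensional S \<longleftrightarrow> top_of_set S dim_le 1 \<and> \<not> top_of_set S dim_le 0"

end

theory Submission
  imports Defs
begin

text \<open>
  With \<open>d = A - B - C + D\<close> the equation reads
  \<open>A + \<beta> (B - A) + \<alpha> (C - A) + \<alpha>\<beta> d = 0\<close>. A vector of the plane vanishes iff its
  determinants with two independent vectors do. If \<open>AC\<close> and \<open>BD\<close> are not parallel, then
  \<open>C - A\<close> and \<open>d\<close> are independent: the determinant with \<open>d\<close> gives a linear relation between
  \<open>\<alpha>\<close> and \<open>\<beta>\<close>, and substituting it into the one with \<open>C - A\<close> gives a quadratic equation for
  \<open>\<beta>\<close>. If \<open>AC\<close> and \<open>BD\<close> are parallel but \<open>AB\<close> and \<open>CD\<close> are not, then \<open>C - A = k d\<close> and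
  the equation factors as \<open>P + (\<beta> + k) (B - A + \<alpha> d) = 0\<close>.

  For points on a line through the origin the solution set is the zero set of a nonconstant
  function \<open>a + b \<beta> + c \<alpha> + d \<alpha>\<beta>\<close>. It contains a graph over an interval or a line, hence is not
  zero-dimensional; and all but at most one horizontal and one vertical line meet it in
  finitely many points, so small squares in general position have finite frontier in it.
\<close>

section \<open>Determinants, parallel vectors and lines in the plane\<close>

lemma p_eq: "p V W = V$1 * W$2 - V$2 * W$1"
  by (simp add: p_def det_2)

lemma p_bilinear:
  "p (U + V) W = p U W + p V W" "p W (U + V) = p W U + p W V"
  "p (r *\<^sub>R U) W = r * p U W" "p W (r *\<^sub>R U) = r * p W U"
  "p 0 W = 0" "p W 0 = 0" "p W W = 0"
  by (simp_all add: p_eq algebra_simps)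

lemma p_diff:
  "p (U - V) W = p U W - p V W" "p W (U - V) = p W U - p W V"
  by (simp_all add: p_eq algebra_simps)

lemma p_antisym: "p V W = - p W V"
  by (simp add: p_eq algebra_simps)

lemma p_eq_0_imp_scaleR:
  assumes "p V W = 0" "W \<noteq> 0"
  shows "\<exists>r. V = r *\<^sub>R W"
proof -
  consider "W$1 \<noteq> 0" | "W$2 \<noteq> 0"
    using assms(2) by (auto simp: vec_eq_iff forall_2)
  then show ?thesis
  proof cases
    case 1
    then have "V = (V$1 / W$1) *\<^sub>R W"
      using assms(1) by (simp add: p_eq vec_eq_iff forall_2 field_simps)
    then show ?thesis ..
  next
    case 2
    then have "V = (V$2 / W$2) *\<^sub>R W"
      using assms(1) by (simp add: p_eq vec_eq_iff forall_2 field_simps)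
    then show ?thesis ..
  qed
qed

lemma eq_0_iff_p_eq_0:
  assumes "p b d \<noteq> 0"
  shows "E = 0 \<longleftrightarrow> p E b = 0 \<and> p E d = 0"
proof
  \<comment> \<open>The determinant with \<open>d\<close> puts \<open>E\<close> on the line spanned
    by \<open>d\<close>; the one with \<open>b\<close> then forces the factor to be zero.\<close>
  assume E: "p E b = 0 \<and> p E d = 0"
  moreover have "d \<noteq> 0"
    using assms by (auto simp: p_bilinear)
  ultimately obtain r where "E = r *\<^sub>R d"
    using p_eq_0_imp_scaleR by blast
  with E assms show "E = 0"
    by (auto simp: p_bilinear p_antisym[of d b])
qed (simp add: p_bilinear)

lemma parallel_iff: "parallel V W \<longleftrightarrow> p V W = 0"
proof
  assume "p V W = 0"
  show "parallel V W"
  proof (cases "W = 0")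
    case True
    then show ?thesis
      using dim_le_card'[of "{V}"] by (simp add: parallel_def insert_commute)
  next
    case False
    with \<open>p V W = 0\<close> obtain r where "V = r *\<^sub>R W"
      using p_eq_0_imp_scaleR by blast
    then have "span {V, W} = span {W}"
      by (simp add: span_redundant span_mul span_base)
    then show ?thesis
      using dim_le_card'[of "{W}"] by (simp add: parallel_def)
  qed
next
  assume par: "parallel V W"
  show "p V W = 0"
  proof (rule ccontr)
    assume "p V W \<noteq> 0"
    then have "V \<noteq> W" "W \<noteq> 0" "V \<notin> span {W}"
      by (auto simp: p_bilinear span_singleton)
    then have "independent {V, W}" 
      by (simp add: independent_insert)
    with \<open>V \<noteq> W\<close> have "dim {V, W} = 2"
      by (simp add: dim_eq_card_independent)
    with par show False
      by (simp add: parallel_def)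
  qed
qed

lemma edges_parallel_iff: "edges_parallel X Y Z T \<longleftrightarrow> p (X - Y) (Z - T) = 0"
  by (simp add: edges_parallel_def parallel_iff)

lemma is_line_range:
  assumes "u \<noteq> 0"
  shows "is_line (range (\<lambda>t. P + t *\<^sub>R u))"
proof -
  have "range (\<lambda>t. P + t *\<^sub>R u) = affine hull {P, P + u}"
    by (simp add: affine_hull_2_alt)
  with assms show ?thesis
    by (simp add: is_line_def)
qed

lemma is_line_through:
  assumes "is_line l" "P \<in> l"
  obtains u where "u \<noteq> 0" "l = range (\<lambda>t. P + t *\<^sub>R u)"
proof -
  have "l \<noteq> {P}"
    using assms(1) by (auto simp: is_line_def)
  then obtain Q where Q: "Q \<in> l" "Q \<noteq> P"
    using assms(2) by blast
  \<comment> \<open>Two distinct points already span an affine set of dimension 1, which lies in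
    \<open>l\<close> and so fills it.\<close>
  then have "affine hull {P, Q} = l"
    using assms by (intro affine_dim_equal) (auto simp: is_line_def hull_minimal)
  then have "l = range (\<lambda>t. P + t *\<^sub>R (Q - P))"
    by (simp add: affine_hull_2_alt)
  with Q show thesis
    by (intro that[of "Q - P"]) auto
qed

section \<open>The equation, parallelograms, and the case without parallel opposite edges\<close>

lemma solutions_iff:
  "(\<alpha>, \<beta>) \<in> solutions A B C D \<longleftrightarrow>
     A + \<beta> *\<^sub>R (B - A) + \<alpha> *\<^sub>R (C - A) + (\<alpha> * \<beta>) *\<^sub>R (A - B - C + D) = 0"
proof -
  have "A + \<beta> *\<^sub>R (B - A) + \<alpha> *\<^sub>R (C - A) + (\<alpha> * \<beta>) *\<^sub>R (A - B - C + D) =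
    (1 - \<alpha>) *\<^sub>R ((1 - \<beta>) *\<^sub>R A + \<beta> *\<^sub>R B) + \<alpha> *\<^sub>R ((1 - \<beta>) *\<^sub>R C + \<beta> *\<^sub>R D)"
    by (simp add: algebra_simps)
  then show ?thesis
    unfolding solutions_def by auto
qed

text \<open>The bilinear expression is symmetric under exchanging the two parameters together with
  \<open>B\<close> and \<open>C\<close>. This carries the result for \<open>AC\<close> parallel to
  \<open>BD\<close> over to \<open>AB\<close> parallel to \<open>CD\<close>.\<close>

lemma solutions_swap: "solutions A B C D = prod.swap ` solutions A C B D"
proof -
  have "(\<alpha>, \<beta>) \<in> solutions A B C D \<longleftrightarrow> (\<beta>, \<alpha>) \<in> solutions A C B D" for \<alpha> \<beta>
    by (simp add: solutions_iff algebra_simps)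
  then show ?thesis
    by (force simp: image_iff)
qed

text \<open>The bilinear term vanishes, and the remaining linear system is solved by Cramer's rule.
  Its determinant is the common denominator, \<open>p (B - A) (C - A)\<close>.\<close>

lemma solutions_parallelogram:
  assumes "\<not> collinear {A, B, C, D}" "parallelogram A B D C"
  shows "p B C + p C A + p A B \<noteq> 0"
    and "solutions A B C D =
      {(p A B / (p B C + p C A + p A B), p C A / (p B C + p C A + p A B))}"
proof -
  define s where "s = p B C + p C A + p A B"
  have D: "A - B - C + D = 0"
    using assms(2) by (simp add: parallelogram_def)
  then have D': "D = A + (B - A) + (C - A)"
    by (simp add: algebra_simps)
  have s: "s = p (B - A) (C - A)"
    by (simp add: s_def p_eq algebra_simps)
  show s0: "s \<noteq> 0"
  proof
    assume "s = 0"
    \<comment> \<open>A zero determinant puts \<open>B\<close> and \<open>C\<close> on a common line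
      through \<open>A\<close>; \<open>D = B + C - A\<close> then lies on it too. If
      \<open>C = A\<close>, the vector \<open>B - A\<close> serves as direction, even when it is
      zero.\<close>
    have "\<exists>u r t. B = A + r *\<^sub>R u \<and> C = A + t *\<^sub>R u"
    proof (cases "C = A")
      case True
      then show ?thesis
        by (intro exI[of _ "B - A"] exI[of _ 1] exI[of _ 0]) simp
    next
      case False
      then obtain r where "B - A = r *\<^sub>R (C - A)"
        using p_eq_0_imp_scaleR \<open>s = 0\<close> s by (metis right_minus_eq)
      then show ?thesis
        by (intro exI[of _ "C - A"] exI[of _ r] exI[of _ 1]) (simp add: algebra_simps)
    qed
    then obtain u r t where u: "B = A + r *\<^sub>R u" "C = A + t *\<^sub>R u"
      by blast
    then have "D = A + (r + t) *\<^sub>R u"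
      using D' by (simp add: algebra_simps)
    with u have "\<forall>x\<in>{A, B, C, D}. \<exists>c. x = A + c *\<^sub>R u"
      by (auto intro: exI[of _ 0])
    then show False
      using assms(1) unfolding collinear_alt by blast
  qed
  have "(\<alpha>, \<beta>) \<in> solutions A B C D \<longleftrightarrow> (\<alpha>, \<beta>) = (p A B / s, p C A / s)" for \<alpha> \<beta>
  proof -
    have "(\<alpha>, \<beta>) \<in> solutions A B C D \<longleftrightarrow> A + \<beta> *\<^sub>R (B - A) + \<alpha> *\<^sub>R (C - A) = 0"
      by (simp add: solutions_iff D)
    also have "\<dots> \<longleftrightarrow> p A (B - A) - \<alpha> * s = 0 \<and> p A (C - A) + \<beta> * s = 0"
      using s0 by (subst eq_0_iff_p_eq_0[of "B - A" "C - A"])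
        (simp_all add: s p_bilinear p_antisym[of "C - A" "B - A"])
    also have "\<dots> \<longleftrightarrow> \<alpha> = p A B / s \<and> \<beta> = p C A / s"
      using s0 p_antisym[of A C] by (auto simp: p_bilinear p_diff(2) field_simps)
    finally show ?thesis by simp
  qed
  then show "solutions A B C D = {(p A B / s, p C A / s)}"
    by auto
qed

text \<open>With \<open>d = A - B - C + D\<close>, the denominators are
  \<open>E1 = p (C - A) d\<close> and \<open>E2 = p (B - A) d\<close>. They equal the determinants
  of the two pairs of opposite edges, so they are nonzero exactly when these are not
  parallel.\<close>

lemma solutions_not_parallel:
  fixes A B C D
  defines "E1 \<equiv> p A B + p B C + p C D + p D A"
    and "E2 \<equiv> p A C + p C B + p B D + p D A"
    and "N1 \<equiv> 2 * p A B + p B C + p D A"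
    and "N2 \<equiv> 2 * p A C + p C B + p D A"
    and "\<Delta> \<equiv> (p A D + p C B)\<^sup>2 - 4 * p A B * p C D"
  assumes "p (A - B) (C - D) \<noteq> 0" "p (A - C) (B - D) \<noteq> 0"
  shows "E1 \<noteq> 0" "E2 \<noteq> 0"
    and "\<Delta> \<ge> 0 \<Longrightarrow> solutions A B C D =
      {((N1 + sqrt \<Delta>) / (2 * E1), (N2 - sqrt \<Delta>) / (2 * E2)),
       ((N1 - sqrt \<Delta>) / (2 * E1), (N2 + sqrt \<Delta>) / (2 * E2))}"
    and "\<Delta> < 0 \<Longrightarrow> solutions A B C D = {}"
proof -
  define d where "d = A - B - C + D"
  have E1: "E1 = p (C - A) d" and E1': "E1 = p (A - C) (B - D)"
    and E2: "E2 = p (B - A) d" and E2': "E2 = p (A - B) (C - D)"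
    by (simp_all add: E1_def E2_def d_def p_eq algebra_simps)
  show 1: "E1 \<noteq> 0" and 2: "E2 \<noteq> 0"
    using assms(6,7) E1' E2' by simp_all
  have lin: "N1 + N2 = - 2 * p A d"
    by (simp add: N1_def N2_def d_def p_eq algebra_simps)
  have N2: "N2 = - (p (B - A) (C - A) + p A d)"
    by (simp add: N2_def d_def p_eq algebra_simps)
  \<comment> \<open>This identifies \<Delta> as the discriminant of the quadratic in \<beta> with
    coefficients \<open>E2\<close>, \<open>- N2\<close> and \<open>p A (C - A)\<close>.\<close>
  have \<Delta>: "\<Delta> = N2\<^sup>2 - 4 * E2 * p A (C - A)"
    by (simp add: \<Delta>_def N2_def E2_def p_eq power2_eq_square algebra_simps)
  have sol: "(\<alpha>, \<beta>) \<in> solutions A B C D \<longleftrightarrow>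
      2 * E1 * \<alpha> + 2 * E2 * \<beta> = N1 + N2 \<and> (2 * E2 * \<beta> - N2)\<^sup>2 = \<Delta>" for \<alpha> \<beta>
  proof -
    have "(\<alpha>, \<beta>) \<in> solutions A B C D \<longleftrightarrow>
        p A (C - A) + \<beta> * p (B - A) (C - A) - \<beta> * (\<alpha> * E1) = 0 \<and>
        p A d + \<beta> * E2 + \<alpha> * E1 = 0"
      unfolding solutions_iff d_def[symmetric] using 1
      by (subst eq_0_iff_p_eq_0[of "C - A" d])
        (simp_all add: E1[symmetric] E2[symmetric] p_bilinear p_antisym[of d "C - A"] mult_ac)
    also have "\<dots> \<longleftrightarrow> 2 * E1 * \<alpha> + 2 * E2 * \<beta> = N1 + N2 \<and>
        p A (C - A) - N2 * \<beta> + E2 * \<beta>\<^sup>2 = 0"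
    proof -
      have "p A (C - A) + \<beta> * p (B - A) (C - A) - \<beta> * (\<alpha> * E1) =
          p A (C - A) - N2 * \<beta> + E2 * \<beta>\<^sup>2" if "p A d + \<beta> * E2 + \<alpha> * E1 = 0"
      proof -
        have \<alpha>: "\<alpha> * E1 = - p A d - \<beta> * E2" using that by linarith
        show ?thesis
          unfolding N2 \<alpha> by (simp add: power2_eq_square algebra_simps)
      qed
      then show ?thesis
        unfolding lin by (auto simp: algebra_simps)
    qed
    also have "p A (C - A) - N2 * \<beta> + E2 * \<beta>\<^sup>2 = 0 \<longleftrightarrow> (2 * E2 * \<beta> - N2)\<^sup>2 = \<Delta>"
    proof -
      \<comment> \<open>Completing the square, after multiplication by the nonzero number
        \<open>4 * E2\<close>.\<close>
      have "(2 * E2 * \<beta> - N2)\<^sup>2 - \<Delta> = 4 * E2 * (p A (C - A) - N2 * \<beta> + E2 * \<beta>\<^sup>2)"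
        unfolding \<Delta> by (simp add: power2_eq_square algebra_simps)
      then show ?thesis
        using 2 by (metis mult_eq_0_iff right_minus_eq zero_neq_numeral)
    qed
    finally show ?thesis .
  qed
  show "solutions A B C D = {}" if "\<Delta> < 0"
  proof -
    have "(2 * E2 * \<beta> - N2)\<^sup>2 \<noteq> \<Delta>" for \<beta>
      using that by (metis not_less zero_le_power2)
    then show ?thesis using sol by auto
  qed
  assume "\<Delta> \<ge> 0"
  have "(\<alpha>, \<beta>) \<in> solutions A B C D \<longleftrightarrow>
      (\<alpha> = (N1 + sqrt \<Delta>) / (2 * E1) \<and> \<beta> = (N2 - sqrt \<Delta>) / (2 * E2)) \<or>
      (\<alpha> = (N1 - sqrt \<Delta>) / (2 * E1) \<and> \<beta> = (N2 + sqrt \<Delta>) / (2 * E2))" for \<alpha> \<beta>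
  proof -
    have "(2 * E2 * \<beta> - N2)\<^sup>2 = \<Delta> \<longleftrightarrow>
        2 * E2 * \<beta> - N2 = - sqrt \<Delta> \<or> 2 * E2 * \<beta> - N2 = sqrt \<Delta>"
      using power2_eq_iff[of "2 * E2 * \<beta> - N2" "sqrt \<Delta>"] \<open>\<Delta> \<ge> 0\<close> by auto
    \<comment> \<open>With denominators cleared, everything is linear in
      \<open>2 * E1 * \<alpha>\<close> and \<open>2 * E2 * \<beta>\<close>. Their sum is
      \<open>N1 + N2\<close>, so the root enters the two coordinates with opposite signs.\<close>
    moreover have "\<alpha> = x / (2 * E1) \<longleftrightarrow> 2 * E1 * \<alpha> = x" "\<beta> = x / (2 * E2) \<longleftrightarrow> 2 * E2 * \<beta> = x" for x
      using 1 2 by (auto simp: field_simps)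
    ultimately show ?thesis
      unfolding sol by (smt (verit))
  qed
  then show "solutions A B C D =
      {((N1 + sqrt \<Delta>) / (2 * E1), (N2 - sqrt \<Delta>) / (2 * E2)),
       ((N1 - sqrt \<Delta>) / (2 * E1), (N2 + sqrt \<Delta>) / (2 * E2))}"
    by auto
qed

section \<open>Trapezia\<close>

lemma parallel_lines_through:
  assumes "d \<noteq> 0" "X - Y = r *\<^sub>R d" "Z - T = s *\<^sub>R d" "r \<noteq> 0 \<or> s \<noteq> 0"
  shows "is_line l \<and> P \<in> l \<and> line_parallel_to_edge l X Y \<and> line_parallel_to_edge l Z T
    \<longleftrightarrow> l = range (\<lambda>t. P + t *\<^sub>R d)"
proof
  assume l: "is_line l \<and> P \<in> l \<and> line_parallel_to_edge l X Y \<and> line_parallel_to_edge l Z T"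
  then obtain u where u: "u \<noteq> 0" "l = range (\<lambda>t. P + t *\<^sub>R u)"
    using is_line_through by blast
  then have "P + 1 *\<^sub>R u \<in> l" by blast
  then have "p u (X - Y) = 0" "p u (Z - T) = 0"
    using l unfolding line_parallel_to_edge_def parallel_iff by force+
  \<comment> \<open>One of the edges is nondegenerate, and that edge fixes the direction; the other
    may be a single point.\<close>
  then have "p u d = 0"
    using assms by (auto simp: p_bilinear)
  then obtain k where k: "u = k *\<^sub>R d"
    using p_eq_0_imp_scaleR assms(1) by blast
  with u have "k \<noteq> 0" by auto
  then have "P + t *\<^sub>R d \<in> l" for t
    unfolding u(2) k by (intro image_eqI[of _ _ "t / k"]) auto
  moreover have "P + t *\<^sub>R u \<in> range (\<lambda>t. P + t *\<^sub>R d)" for t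
    unfolding k by auto
  ultimately show "l = range (\<lambda>t. P + t *\<^sub>R d)"
    using u(2) by blast
next
  assume l: "l = range (\<lambda>t. P + t *\<^sub>R d)"
  have "P = P + 0 *\<^sub>R d" by simp
  then have "P \<in> l" unfolding l by blast
  moreover have "U - V = (t - t') *\<^sub>R d" if "U = P + t *\<^sub>R d" "V = P + t' *\<^sub>R d" for U V t t'
    using that by (simp add: algebra_simps)
  then have "line_parallel_to_edge l X Y" "line_parallel_to_edge l Z T"
    unfolding line_parallel_to_edge_def parallel_iff l assms(2,3)
    by (fastforce simp: p_bilinear)+
  ultimately show "is_line l \<and> P \<in> l \<and> line_parallel_to_edge l X Y \<and> line_parallel_to_edge l Z T"
    using is_line_range[OF assms(1)] l by blast
qed

text \<open>Here \<open>b\<close> and \<open>b + d\<close> are directions of \<open>AB\<close> and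
  \<open>CD\<close>, \<open>P\<close> is where these lines meet, and \<open>d\<close> is the
  direction of \<open>AC\<close> and \<open>BD\<close>. Hence \<open>p P d = 0\<close> says that the
  line through \<open>P\<close> parallel to \<open>AC\<close> and \<open>BD\<close> contains the
  origin. The determinant with \<open>d\<close> determines \<beta>; the one with \<open>b\<close>
  then leaves \<alpha> free, excludes it or determines it.\<close>

lemma solutions_trapezium:
  assumes bd: "p b d \<noteq> 0"
    and A: "A = P + k *\<^sub>R b" and B: "B = P + (k + 1) *\<^sub>R b"
    and C: "C = P + k *\<^sub>R (b + d)" and D: "D = P + (k + 1) *\<^sub>R (b + d)"
  defines "E2 \<equiv> p A C + p C B + p B D + p D A"
    and "\<beta>\<^sub>0 \<equiv> (p A B + p A C + p D A) / (p A C + p C B + p B D + p D A)"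
  shows "E2 \<noteq> 0"
    and "P = 0 \<Longrightarrow> solutions A B C D = {(\<gamma>, \<beta>\<^sub>0) | \<gamma>. True}"
    and "P \<noteq> 0 \<Longrightarrow> p P d = 0 \<Longrightarrow> solutions A B C D = {}"
    and "p P d \<noteq> 0 \<Longrightarrow> p A B + p D C \<noteq> 0"
    and "p P d \<noteq> 0 \<Longrightarrow> solutions A B C D = {(p A B / (p A B + p D C), \<beta>\<^sub>0)}"
proof -
  have E2: "E2 = p b d"
    unfolding E2_def A B C D by (simp add: p_eq algebra_simps)
  then show "E2 \<noteq> 0" using bd by simp
  have "p A B + p A C + p D A = - k * p b d - p P d"
    unfolding A B C D by (simp add: p_eq algebra_simps)
  then have \<beta>\<^sub>0: "\<beta>\<^sub>0 = - k - p P d / p b d"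
    unfolding \<beta>\<^sub>0_def E2_def[symmetric] E2 using bd by (simp add: field_simps)
  have AB: "p A B = p P b"
    unfolding A B by (simp add: p_eq algebra_simps)
  have ABDC: "p A B + p D C = - p P d"
    unfolding A B C D by (simp add: p_eq algebra_simps)
  then show "p P d \<noteq> 0 \<Longrightarrow> p A B + p D C \<noteq> 0"
    by simp
  have sol: "(\<alpha>, \<beta>) \<in> solutions A B C D \<longleftrightarrow>
      p P b - \<alpha> * ((\<beta> + k) * p b d) = 0 \<and> p P d + (\<beta> + k) * p b d = 0" for \<alpha> \<beta>
  proof -
    have "(\<alpha>, \<beta>) \<in> solutions A B C D \<longleftrightarrow> P + (\<beta> + k) *\<^sub>R (b + \<alpha> *\<^sub>R d) = 0"
      unfolding solutions_iff A B C D by (simp add: algebra_simps)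
    then show ?thesis
      using bd by (subst (asm) eq_0_iff_p_eq_0[of b d])
        (simp_all add: p_bilinear p_antisym[of d b] mult_ac)
  qed
  show "solutions A B C D = {(\<gamma>, \<beta>\<^sub>0) | \<gamma>. True}" if "P = 0"
  proof -
    have "(\<alpha>, \<beta>) \<in> solutions A B C D \<longleftrightarrow> \<beta> = \<beta>\<^sub>0" for \<alpha> \<beta>
      unfolding sol \<beta>\<^sub>0 using that bd by (auto simp: p_bilinear)
    then show ?thesis by auto
  qed
  show "solutions A B C D = {}" if "P \<noteq> 0" "p P d = 0"
  proof -
    \<comment> \<open>The determinant with \<open>d\<close> forces \<open>\<beta> + k = 0\<close>,
      which would leave \<open>p P b = 0\<close> in the other equation.\<close>
    have "p P b \<noteq> 0"
      using that eq_0_iff_p_eq_0[OF bd, of P] by simp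
    then have "(\<alpha>, \<beta>) \<notin> solutions A B C D" for \<alpha> \<beta>
      unfolding sol using that bd by auto
    then show ?thesis by auto
  qed
  show "solutions A B C D = {(p A B / (p A B + p D C), \<beta>\<^sub>0)}" if "p P d \<noteq> 0"
  proof -
    have "(\<alpha>, \<beta>) \<in> solutions A B C D \<longleftrightarrow> \<alpha> = p P b / - p P d \<and> \<beta> = \<beta>\<^sub>0" for \<alpha> \<beta>
    proof -
      have "(\<alpha>, \<beta>) \<in> solutions A B C D \<longleftrightarrow>
          p P b + \<alpha> * p P d = 0 \<and> (\<beta> + k) * p b d = - p P d"
        unfolding sol by (auto simp: add_eq_0_iff)
      also have "\<dots> \<longleftrightarrow> \<alpha> = p P b / - p P d \<and> \<beta> = \<beta>\<^sub>0"
      proof -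
        have "(\<beta> + k) * p b d = - p P d \<longleftrightarrow> \<beta> + k = - p P d / p b d"
          using bd by (metis nonzero_eq_divide_eq)
        moreover have "p P b + \<alpha> * p P d = 0 \<longleftrightarrow> \<alpha> = p P b / - p P d"
          using that by (metis add_eq_0_iff minus_divide_right minus_divide_left nonzero_eq_divide_eq)
        ultimately show ?thesis unfolding \<beta>\<^sub>0 by auto
      qed
      finally show ?thesis .
    qed
    then have "solutions A B C D = {(p P b / - p P d, \<beta>\<^sub>0)}" by auto
    then show ?thesis
      unfolding ABDC unfolding AB .
  qed
qed

text \<open>The conditions on \<open>P\<close> and on \<open>l\<close> are each equivalent to an
  equation, so the quantifiers collapse to one point and one line, and
  \<open>solutions_trapezium\<close> applies.\<close>

lemma trapezium:
  assumes par: "p (A - C) (B - D) = 0" and npar: "p (A - B) (C - D) \<noteq> 0"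
  shows "(\<exists>!P. P \<in> affine hull {A, B} \<inter> affine hull {C, D}) \<and>
    (\<forall>P. P \<in> affine hull {A, B} \<inter> affine hull {C, D} \<longrightarrow>
      (\<exists>!l. is_line l \<and> P \<in> l \<and>
            line_parallel_to_edge l A C \<and> line_parallel_to_edge l B D) \<and>
      (\<forall>l. is_line l \<and> P \<in> l \<and>
            line_parallel_to_edge l A C \<and> line_parallel_to_edge l B D \<longrightarrow>
        (P = 0 \<longrightarrow>
          p A C + p C B + p B D + p D A \<noteq> 0 \<and>
          solutions A B C D =
            {(\<gamma>, (p A B + p A C + p D A) / (p A C + p C B + p B D + p D A)) | \<gamma>. True}) \<and>
        (P \<noteq> 0 \<and> 0 \<in> l \<longrightarrow> solutions A B C D = {}) \<and>
        (0 \<notin> l \<longrightarrow>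
          p A B + p D C \<noteq> 0 \<and> p A C + p C B + p B D + p D A \<noteq> 0 \<and>
          solutions A B C D =
            {(p A B / (p A B + p D C),
              (p A B + p A C + p D A) / (p A C + p C B + p B D + p D A))})))"
proof -
  define b d where "b = B - A" and "d = A - B - C + D"
  have "p b d = p (A - B) (C - D)"
    by (simp add: b_def d_def p_eq algebra_simps)
  with npar have bd: "p b d \<noteq> 0" by simp
  then have "d \<noteq> 0" by (auto simp: p_bilinear)
  have "p (C - A) d = 0"
    using par by (simp add: d_def p_eq algebra_simps)
  then obtain k where k: "C - A = k *\<^sub>R d"
    using p_eq_0_imp_scaleR \<open>d \<noteq> 0\<close> by blast
  \<comment> \<open>The points \<open>A + s b\<close> and
    \<open>C + s (b + d) = A + s b + (s + k) d\<close> coincide at \<open>s = - k\<close>; this is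
    the intersection of the two lines.\<close>
  define Q where "Q = A - k *\<^sub>R b"
  have A: "A = Q + k *\<^sub>R b"
    by (simp add: Q_def)
  have "B = A + b" by (simp add: b_def)
  then have B: "B = Q + (k + 1) *\<^sub>R b"
    by (simp add: A algebra_simps)
  have C: "C = Q + k *\<^sub>R (b + d)"
    using k A by (simp add: algebra_simps)
  have "D = C + b + d"
    by (simp add: b_def d_def)
  then have D: "D = Q + (k + 1) *\<^sub>R (b + d)"
    by (simp add: C algebra_simps)
  have hulls: "P \<in> affine hull {A, B} \<inter> affine hull {C, D} \<longleftrightarrow> P = Q" for P
  proof -
    have AB: "affine hull {A, B} = range (\<lambda>t. Q + (k + t) *\<^sub>R b)"
      unfolding affine_hull_2_alt A B by (simp add: algebra_simps)
    have CD: "affine hull {C, D} = range (\<lambda>t. Q + (k + t) *\<^sub>R (b + d))"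
      unfolding affine_hull_2_alt C D by (simp add: algebra_simps)
    have "Q = Q + (k + - k) *\<^sub>R b" "Q = Q + (k + - k) *\<^sub>R (b + d)" by simp_all
    then have "Q \<in> affine hull {A, B} \<inter> affine hull {C, D}"
      unfolding AB CD by blast
    moreover have "P = Q" if P: "P \<in> affine hull {A, B} \<inter> affine hull {C, D}"
    proof -
      obtain t t' where t: "P = Q + t *\<^sub>R b" "P = Q + t' *\<^sub>R (b + d)"
        using P unfolding AB CD by (elim IntE rangeE)
      then have "p (t *\<^sub>R b) b = p (t' *\<^sub>R (b + d)) b" by simp
      then have "t' = 0"
        using bd by (simp add: p_bilinear p_antisym[of d b])
      with t show ?thesis by simp
    qed
    ultimately show ?thesis by blast
  qed
  \<comment> \<open>The factors \<open>- k\<close> and \<open>- (k + 1)\<close> cannot both vanish,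
    so at least one of the parallel edges is nondegenerate.\<close>
  have edges: "A - C = - k *\<^sub>R d" "B - D = - (k + 1) *\<^sub>R d"
    unfolding A B C D by (simp_all add: algebra_simps)
  have lines: "is_line l \<and> P \<in> l \<and> line_parallel_to_edge l A C \<and> line_parallel_to_edge l B D
      \<longleftrightarrow> l = range (\<lambda>t. P + t *\<^sub>R d)" for l P
    by (rule parallel_lines_through[OF \<open>d \<noteq> 0\<close> edges]) auto
  have "0 \<in> range (\<lambda>t. Q + t *\<^sub>R d) \<longleftrightarrow> p Q d = 0"
  proof
    assume "0 \<in> range (\<lambda>t. Q + t *\<^sub>R d)"
    then obtain t where "0 = Q + t *\<^sub>R d" by blast
    then have "p (Q + t *\<^sub>R d) d = 0" by (metis p_bilinear(5))
    then show "p Q d = 0" by (simp add: p_bilinear)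
  next
    assume "p Q d = 0"
    then obtain t where "Q = t *\<^sub>R d"
      using p_eq_0_imp_scaleR \<open>d \<noteq> 0\<close> by blast
    then have "0 = Q + (- t) *\<^sub>R d" by simp
    then show "0 \<in> range (\<lambda>t. Q + t *\<^sub>R d)" by blast
  qed
  then show ?thesis
    unfolding hulls lines using solutions_trapezium[OF bd A B C D] by simp
qed

section \<open>Small inductive dimension of plane curves\<close>

lemma finite_dim_le_0:
  fixes F :: "'a::t1_space set"
  assumes "finite F"
  shows "top_of_set F dim_le 0"
proof (intro dimension_le.intros)
  fix V a
  assume "openin (top_of_set F) V" "a \<in> V"
  then have "a \<in> F"
    using openin_subset by fastforce
  \<comment> \<open>The other points of \<open>F\<close> form a finite, hence closed, set. So
    \<open>{a}\<close> is clopen in \<open>F\<close>, and its empty frontier has dimension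
    -1.\<close>
  then have "F \<inter> (- (F - {a})) = {a}" by auto
  moreover have "open (- (F - {a}))"
    using assms by (intro open_Compl finite_imp_closed) simp
  ultimately have "openin (top_of_set F) {a}"
    by (metis openin_open)
  moreover have "closedin (top_of_set F) {a}"
    using \<open>a \<in> F\<close> by (simp add: closed_subset)
  ultimately have "openin (top_of_set F) {a}" "top_of_set F frontier_of {a} = {}"
    by (simp_all add: frontier_of_eq_empty \<open>a \<in> F\<close>)
  then show "\<exists>U. a \<in> U \<and> U \<subseteq> V \<and> openin (top_of_set F) U \<and>
      subtopology (top_of_set F) (top_of_set F frontier_of U) dim_le 0 - 1"
    using \<open>a \<in> V\<close> by (intro exI[of _ "{a}"]) auto
qed simp

text \<open>Dimension at most 0 passes to the subset \<open>T\<close> and provides clopen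
  neighbourhoods of \<open>x\<close> in \<open>T\<close> that avoid \<open>y\<close>, which
  connectedness forbids.\<close>

lemma connected_imp_not_dim_le_0:
  fixes T :: "'a::t1_space set"
  assumes "connected T" "T \<subseteq> S" "x \<in> T" "y \<in> T" "x \<noteq> y"
  shows "\<not> top_of_set S dim_le 0"
proof
  assume "top_of_set S dim_le 0"
  then have "top_of_set T dim_le 0"
    using assms(2) dimension_le_subtopologies by blast
  moreover have "openin (top_of_set T) (T \<inter> - {y})"
    by (intro openin_open_Int) auto
  moreover have "x \<in> T \<inter> - {y}"
    using assms by simp
  ultimately obtain U K where "closedin (top_of_set T) K" "openin (top_of_set T) K"
    "x \<in> U" "U \<subseteq> K" "K \<subseteq> T \<inter> - {y}"
    unfolding dimension_le_0_neighbourhood_base_of_clopen neighbourhood_base_of by metis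
  then show False
    using assms(1,4) unfolding connected_clopen by blast
qed

lemma dim_le_1_plane:
  fixes S :: "(real \<times> real) set"
  assumes "finite N" "finite M"
    and "\<And>x. x \<notin> N \<Longrightarrow> finite {y. (x, y) \<in> S}"
    and "\<And>y. y \<notin> M \<Longrightarrow> finite {x. (x, y) \<in> S}"
  shows "top_of_set S dim_le 1"
proof (intro dimension_le.intros)
  fix V a
  assume "openin (top_of_set S) V" "a \<in> V"
  then obtain O' where O: "open O'" "V = S \<inter> O'"
    by (auto simp: openin_open)
  with \<open>a \<in> V\<close> obtain e where e: "e > 0" "ball a e \<subseteq> O'"
    by (meson IntD2 open_contains_ball)
  obtain x y where a: "a = (x, y)" by fastforce
  \<comment> \<open>The half-sides \<open>r\<close> for which a side of the square around
    \<open>(x, y)\<close> lies on a vertical line over \<open>N\<close> or a horizontal line at a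
    height in \<open>M\<close>. They are finitely many, so an admissible \<open>r\<close> below
    \<open>e / 2\<close> exists; that bound keeps the square inside the ball, as
    \<open>\<bar>x - u\<bar> + \<bar>y - v\<bar> < 2 * r < e\<close>.\<close>
  let ?bad = "(\<lambda>z. z - x) ` N \<union> (\<lambda>z. x - z) ` N \<union> (\<lambda>z. z - y) ` M \<union> (\<lambda>z. y - z) ` M"
  have "infinite ({0<..<e / 2} - ?bad)"
    using e assms(1,2) by (intro Diff_infinite_finite) auto
  then obtain r where "r \<in> {0<..<e / 2}" and bad: "r \<notin> ?bad"
    by (metis Diff_iff ex_in_conv finite.emptyI)
  then have r: "0 < r" "2 * r < e" by auto
  have N: "x - r \<notin> N" "x + r \<notin> N" "y - r \<notin> M" "y + r \<notin> M"
    using bad by (force simp: image_iff)+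
  let ?I = "{x - r<..<x + r} \<times> {y - r<..<y + r}" and ?J = "{x - r..x + r} \<times> {y - r..y + r}"
  let ?U = "S \<inter> ?I"
  let ?F = "top_of_set S frontier_of ?U"
  have openU: "openin (top_of_set S) ?U"
    by (intro openin_open_Int open_Times) auto
  have "a \<in> ?U"
    using \<open>a \<in> V\<close> O a r by auto
  have "?I \<subseteq> ball a e"
  proof
    fix z assume "z \<in> ?I"
    then obtain u v where "z = (u, v)" "\<bar>x - u\<bar> < r" "\<bar>y - v\<bar> < r" by auto
    then show "z \<in> ball a e"
      using r sqrt_sum_squares_le_sum_abs[of "x - u" "y - v"]
      by (simp add: a dist_Pair_Pair dist_real_def)
  qed
  then have "?U \<subseteq> V"
    using O e by blast
  have "?F \<subseteq> S \<inter> (?J - ?I)"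
  proof -
    have "closedin (top_of_set S) (S \<inter> ?J)"
      by (intro closedin_closed_Int closed_Times) auto
    moreover have "?U \<subseteq> S \<inter> ?J" by auto
    ultimately have "top_of_set S closure_of ?U \<subseteq> S \<inter> ?J"
      by (metis closure_of_minimal)
    then show ?thesis
      unfolding frontier_of_openin[OF openU] by blast
  qed
  also have "\<dots> \<subseteq> Pair (x - r) ` {v. (x - r, v) \<in> S} \<union> Pair (x + r) ` {v. (x + r, v) \<in> S} \<union>
      (\<lambda>u. (u, y - r)) ` {u. (u, y - r) \<in> S} \<union> (\<lambda>u. (u, y + r)) ` {u. (u, y + r) \<in> S}"
    (is "_ \<subseteq> ?R")
  proof
    fix z assume z: "z \<in> S \<inter> (?J - ?I)"
    obtain u v where uv: "z = (u, v)" by fastforce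
    with z have "(u, v) \<in> S" and "u = x - r \<or> u = x + r \<or> v = y - r \<or> v = y + r"
      by auto
    then show "z \<in> ?R" unfolding uv by blast
  qed
  finally have "?F \<subseteq> ?R" .
  moreover have "finite ?R"
    using N assms(3,4) by (intro finite_UnI finite_imageI) auto
  ultimately have "finite ?F"
    by (rule finite_subset)
  then have "top_of_set ?F dim_le 0"
    by (rule finite_dim_le_0)
  then have "subtopology (top_of_set S) ?F dim_le 1 - 1"
    using frontier_of_subset_topspace[of "top_of_set S" ?U]
    by (simp only: subtopology_subtopology topspace_euclidean_subtopology Int_absorb1 diff_self)
  then show "\<exists>U. a \<in> U \<and> U \<subseteq> V \<and> openin (top_of_set S) U \<and>
      subtopology (top_of_set S) (top_of_set S frontier_of U) dim_le 1 - 1"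
    using \<open>a \<in> ?U\<close> \<open>?U \<subseteq> V\<close> openU by (intro exI conjI)
qed simp

lemma finite_linear_roots:
  fixes a b :: real
  assumes "\<not> (a = 0 \<and> b = 0)"
  shows "finite {x. a + b * x = 0}"
proof (cases "b = 0")
  case False
  then have "{x. a + b * x = 0} \<subseteq> {- a / b}" by (auto simp: field_simps)
  then show ?thesis using finite_subset by blast
qed (use assms in simp)

lemma one_dimensional_bilinear:
  fixes a b c d :: real
  assumes "\<not> (b = 0 \<and> c = 0 \<and> d = 0)"
  shows "one_dimensional {(\<alpha>, \<beta>). a + b * \<beta> + c * \<alpha> + d * (\<alpha> * \<beta>) = 0}" (is "one_dimensional ?S")
  unfolding one_dimensional_def
proof
  \<comment> \<open>For fixed \<open>x\<close> the equation is affine in \<open>y\<close>, with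
    coefficients \<open>a + c * x\<close> and \<open>b + d * x\<close>. It has infinitely many
    solutions only if both vanish; \<open>?M\<close> is the analogue for fixed
    \<open>y\<close>.\<close>
  let ?N = "{x. a + c * x = 0} \<inter> {x. b + d * x = 0}"
  let ?M = "{y. a + b * y = 0} \<inter> {y. c + d * y = 0}"
  show "top_of_set ?S dim_le 1"
  proof (rule dim_le_1_plane[of ?N ?M])
    show "finite ?N" "finite ?M"
      using assms finite_linear_roots by (metis finite_Int)+
    show "finite {y. (x, y) \<in> ?S}" if "x \<notin> ?N" for x
    proof -
      have "{y. (x, y) \<in> ?S} = {y. (a + c * x) + (b + d * x) * y = 0}"
        by (auto simp: algebra_simps)
      then show ?thesis using that finite_linear_roots by auto
    qed
    show "finite {x. (x, y) \<in> ?S}" if "y \<notin> ?M" for y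
    proof -
      have "{x. (x, y) \<in> ?S} = {x. (a + b * y) + (c + d * y) * x = 0}"
        by (auto simp: algebra_simps)
      then show ?thesis using that finite_linear_roots by auto
    qed
  qed
  show "\<not> top_of_set ?S dim_le 0"
  \<comment> \<open>If \<beta> does not occur, the set is a vertical line; otherwise the equation
    can be solved for \<beta> over a suitable interval.\<close>
  proof (cases "b = 0 \<and> d = 0")
    case True
    with assms have "c \<noteq> 0" by simp
    have "connected ((\<lambda>\<beta>::real. (- a / c, \<beta>)) ` UNIV)"
      by (intro connected_continuous_image continuous_intros) auto
    then show ?thesis
    proof (rule connected_imp_not_dim_le_0)
      show "range (\<lambda>\<beta>. (- a / c, \<beta>)) \<subseteq> ?S"
        using True \<open>c \<noteq> 0\<close> by auto
      show "(- a / c, 0) \<in> range (\<lambda>\<beta>. (- a / c, \<beta>))" "(- a / c, 1) \<in> range (\<lambda>\<beta>. (- a / c, \<beta>))"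
        by auto
    qed simp
  next
    case False
    \<comment> \<open>The interval from \<open>t\<close> to \<open>t + 1\<close> starts one unit to
      the right of the pole \<open>- b / d\<close>. If \<open>d = 0\<close>, division by zero gives
      \<open>t = 1\<close>, and the denominator is the nonzero constant \<open>b\<close>.\<close>
    define t where "t = 1 - b / d"
    have nz: "b + d * \<alpha> \<noteq> 0" if "\<alpha> \<in> {t..t + 1}" for \<alpha>
    proof
      assume "b + d * \<alpha> = 0"
      with False have "\<alpha> = - b / d" by (cases "d = 0") (auto simp: field_simps)
      with that show False by (simp add: t_def)
    qed
    define f where "f = (\<lambda>\<alpha>. (\<alpha>, - (a + c * \<alpha>) / (b + d * \<alpha>)))"
    have "continuous_on {t..t + 1} f"
      unfolding f_def using nz by (intro continuous_intros) auto
    then have "connected (f ` {t..t + 1})"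
      by (intro connected_continuous_image) auto
    then show ?thesis
    proof (rule connected_imp_not_dim_le_0)
      show "f ` {t..t + 1} \<subseteq> ?S"
      proof
        fix z assume "z \<in> f ` {t..t + 1}"
        then obtain \<alpha> where "\<alpha> \<in> {t..t + 1}" and z: "z = f \<alpha>" by blast
        then have "(b + d * \<alpha>) * (- (a + c * \<alpha>) / (b + d * \<alpha>)) = - (a + c * \<alpha>)"
          using nz by simp
        moreover define \<beta> where "\<beta> = - (a + c * \<alpha>) / (b + d * \<alpha>)"
        ultimately have "(b + d * \<alpha>) * \<beta> = - (a + c * \<alpha>)" by simp
        then show "z \<in> ?S"
          unfolding z f_def \<beta>_def[symmetric] by (simp add: algebra_simps)
      qed
      show "f t \<in> f ` {t..t + 1}" "f (t + 1) \<in> f ` {t..t + 1}" "f t \<noteq> f (t + 1)"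
        by (auto simp: f_def)
    qed
  qed
qed

section \<open>Points on a common line\<close>

lemma solutions_line_not_through_0:
  assumes "is_line l" "{A, B, C, D} \<subseteq> l" "0 \<notin> l"
  shows "solutions A B C D = {}"
proof -
  \<comment> \<open>The right-hand side of the equation is an affine combination of two affine
    combinations of points of \<open>l\<close>.\<close>
  have "(1 - \<alpha>) *\<^sub>R ((1 - \<beta>) *\<^sub>R A + \<beta> *\<^sub>R B) + \<alpha> *\<^sub>R ((1 - \<beta>) *\<^sub>R C + \<beta> *\<^sub>R D) \<in> l" for \<alpha> \<beta>
    using assms(1,2) by (intro mem_affine) (auto simp: is_line_def)
  with assms(3) have
    "0 \<noteq> (1 - \<alpha>) *\<^sub>R ((1 - \<beta>) *\<^sub>R A + \<beta> *\<^sub>R B) + \<alpha> *\<^sub>R ((1 - \<beta>) *\<^sub>R C + \<beta> *\<^sub>R D)" for \<alpha> \<beta>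
    by metis
  then show ?thesis
    by (simp add: solutions_def)
qed

lemma solutions_line_through_0:
  assumes "\<not> (A = B \<and> B = C \<and> C = D)" "is_line l" "{A, B, C, D} \<subseteq> l" "0 \<in> l"
  shows "one_dimensional (solutions A B C D)"
proof -
  obtain u where "u \<noteq> 0" and l: "l = range (\<lambda>t. 0 + t *\<^sub>R u)"
    using is_line_through assms(2,4) by blast
  have "A \<in> l" "B \<in> l" "C \<in> l" "D \<in> l"
    using assms(3) by auto
  then obtain a b c d where abcd: "A = a *\<^sub>R u" "B = b *\<^sub>R u" "C = c *\<^sub>R u" "D = d *\<^sub>R u"
    unfolding l by auto
  have "(\<alpha>, \<beta>) \<in> solutions A B C D \<longleftrightarrow>
      a + (b - a) * \<beta> + (c - a) * \<alpha> + (a - b - c + d) * (\<alpha> * \<beta>) = 0" for \<alpha> \<beta>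
  proof -
    have "A + \<beta> *\<^sub>R (B - A) + \<alpha> *\<^sub>R (C - A) + (\<alpha> * \<beta>) *\<^sub>R (A - B - C + D) =
        (a + (b - a) * \<beta> + (c - a) * \<alpha> + (a - b - c + d) * (\<alpha> * \<beta>)) *\<^sub>R u"
      unfolding abcd by (simp add: algebra_simps)
    then show ?thesis
      unfolding solutions_iff using \<open>u \<noteq> 0\<close> by simp
  qed
  then have "solutions A B C D =
      {(\<alpha>, \<beta>). a + (b - a) * \<beta> + (c - a) * \<alpha> + (a - b - c + d) * (\<alpha> * \<beta>) = 0}"
    by auto
  \<comment> \<open>If all three coefficients vanished, then \<open>b = c = a\<close> and hence
    \<open>d = a\<close>, so the four points would coincide.\<close>
  moreover have "\<not> (b - a = 0 \<and> c - a = 0 \<and> a - b - c + d = 0)"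
    using assms(1) abcd by auto
  ultimately show ?thesis
    using one_dimensional_bilinear by presburger
qed

theorem proposition6p2:
  fixes A B C D :: "real^2"
  shows
   "(A = B \<and> B = C \<and> C = D \<longrightarrow>
      (A \<noteq> 0 \<longrightarrow> solutions A B C D = {}) \<and>
      (A = 0 \<longrightarrow> solutions A B C D = UNIV))
    \<and>
    (\<forall>l. \<not> (A = B \<and> B = C \<and> C = D) \<and> is_line l \<and> {A, B, C, D} \<subseteq> l \<longrightarrow>
      (0 \<notin> l \<longrightarrow> solutions A B C D = {}) \<and>
      (0 \<in> l \<longrightarrow> one_dimensional (solutions A B C D)))
    \<and>
    (\<not> collinear {A, B, C, D} \<and> parallelogram A B D C \<longrightarrow>
      p B C + p C A + p A B \<noteq> 0 \<and>
      solutions A B C D =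
        {(p A B / (p B C + p C A + p A B), p C A / (p B C + p C A + p A B))})
    \<and>
    (edges_parallel A C B D \<and> \<not> edges_parallel A B C D \<longrightarrow>
      (\<exists>!P. P \<in> affine hull {A, B} \<inter> affine hull {C, D}) \<and>
      (\<forall>P. P \<in> affine hull {A, B} \<inter> affine hull {C, D} \<longrightarrow>
        (\<exists>!l. is_line l \<and> P \<in> l \<and>
              line_parallel_to_edge l A C \<and> line_parallel_to_edge l B D) \<and>
        (\<forall>l. is_line l \<and> P \<in> l \<and>
              line_parallel_to_edge l A C \<and> line_parallel_to_edge l B D \<longrightarrow>
          (P = 0 \<longrightarrow>
            p A C + p C B + p B D + p D A \<noteq> 0 \<and>
            solutions A B C D =
              {(\<gamma>, (p A B + p A C + p D A) / (p A C + p C B + p B D + p D A)) | \<gamma>. True}) \<and>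
          (P \<noteq> 0 \<and> 0 \<in> l \<longrightarrow> solutions A B C D = {}) \<and>
          (0 \<notin> l \<longrightarrow>
            p A B + p D C \<noteq> 0 \<and> p A C + p C B + p B D + p D A \<noteq> 0 \<and>
            solutions A B C D =
              {(p A B / (p A B + p D C),
                (p A B + p A C + p D A) / (p A C + p C B + p B D + p D A))}))))
    \<and>
    (edges_parallel A B C D \<and> \<not> edges_parallel A C B D \<longrightarrow>
      (\<exists>!P. P \<in> affine hull {A, C} \<inter> affine hull {B, D}) \<and>
      (\<forall>P. P \<in> affine hull {A, C} \<inter> affine hull {B, D} \<longrightarrow>
        (\<exists>!l. is_line l \<and> P \<in> l \<and>
              line_parallel_to_edge l A B \<and> line_parallel_to_edge l C D) \<and>
        (\<forall>l. is_line l \<and> P \<in> l \<and>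
              line_parallel_to_edge l A B \<and> line_parallel_to_edge l C D \<longrightarrow>
          (P = 0 \<longrightarrow>
            p A B + p B C + p C D + p D A \<noteq> 0 \<and>
            solutions A B C D =
              {((p A C + p A B + p D A) / (p A B + p B C + p C D + p D A), \<gamma>) | \<gamma>. True}) \<and>
          (P \<noteq> 0 \<and> 0 \<in> l \<longrightarrow> solutions A B C D = {}) \<and>
          (0 \<notin> l \<longrightarrow>
            p A B + p B C + p C D + p D A \<noteq> 0 \<and> p A C + p D B \<noteq> 0 \<and>
            solutions A B C D =
              {((p A C + p A B + p D A) / (p A B + p B C + p C D + p D A),
                p A C / (p A C + p D B))}))))
    \<and>
    (\<not> edges_parallel A B C D \<and> \<not> edges_parallel A C B D \<longrightarrow>
      (let \<Delta> = (p A D + p C B)\<^sup>2 - 4 * p A B * p C D in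
        (\<Delta> \<ge> 0 \<longrightarrow>
          p A B + p B C + p C D + p D A \<noteq> 0 \<and> p A C + p C B + p B D + p D A \<noteq> 0 \<and>
          solutions A B C D =
            {((2 * p A B + p B C + p D A + sqrt \<Delta>) / (2 * (p A B + p B C + p C D + p D A)),
              (2 * p A C + p C B + p D A - sqrt \<Delta>) / (2 * (p A C + p C B + p B D + p D A))),
             ((2 * p A B + p B C + p D A - sqrt \<Delta>) / (2 * (p A B + p B C + p C D + p D A)),
              (2 * p A C + p C B + p D A + sqrt \<Delta>) / (2 * (p A C + p C B + p B D + p D A)))}) \<and>
        (\<Delta> < 0 \<longrightarrow> solutions A B C D = {})))"
proof (intro conjI, goal_cases)
  case 1
  have "(1 - \<alpha>) *\<^sub>R ((1 - \<beta>) *\<^sub>R A + \<beta> *\<^sub>R A) + \<alpha> *\<^sub>R ((1 - \<beta>) *\<^sub>R A + \<beta> *\<^sub>R A) = A" for \<alpha> \<beta>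
    by (simp add: algebra_simps)
  then show ?case
    unfolding solutions_def by auto
next
  case 2
  show ?case
    by (intro allI impI conjI; elim conjE;
        rule solutions_line_not_through_0 solutions_line_through_0; assumption)
next
  case 3
  show ?case
    using solutions_parallelogram by blast
next
  case 4
  show ?case
    unfolding edges_parallel_iff by (rule impI, elim conjE, rule trapezium)
next
  case 5
  \<comment> \<open>This case is \<open>trapezium\<close> with \<open>B\<close> and \<open>C\<close>
    exchanged. The solution sets are transported along \<open>prod.swap\<close>, after which only
    the order of conjuncts differs.\<close>
  have swap: "solutions A C B D = S \<longleftrightarrow> solutions A B C D = prod.swap ` S" for S
    by (auto simp: solutions_swap[of A B C D] inj_image_eq_iff)
  have images: "prod.swap ` {(x, y)} = {(y, x)}" "prod.swap ` {} = {}"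
    "prod.swap ` {(\<gamma>, x) | \<gamma>. True} = {(x, \<gamma>) | \<gamma>. True}" for x y :: real
    by auto
  show ?case
    unfolding edges_parallel_iff
    by (rule impI, elim conjE, drule (1) trapezium,
        simp (no_asm_use) only: swap images,
        simp (no_asm_use) only: conj_ac)
next
  case 6
  show ?case
    unfolding edges_parallel_iff Let_def
    by (intro impI conjI; elim conjE; rule solutions_not_parallel)
qed

end
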